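(* For $N\in\mathbb N$ let $(\Omega_N,\mathcal F_N,Q_N)$ be a sequence of probability spaces. Let $\mathcal X$ be a complete, separable metric space, $\mathcal W$ a relatively compact subset of $\mathcal X$ that is not closed and thus not compact, and $\mathcal Z$ the closure of $\mathcal W$ in $\mathcal X$; thus $\mathcal Z$ is compact. Let $Y_N$ be a sequence of random vectors mapping $\Omega_N$ into $\mathcal W$, and let $I$ be a lower semicontinuous function mapping $\mathcal X$ into $[0,\infty]$. For $A\subset\mathcal X$ denote the infimum of $I$ over $A$ by $I(A)$. Assume the following two limits: for any open ball $B$ in $\mathcal W$ $$\lim_{N\to\infty}\frac1N\log Q_N(Y_N\in B)=-I(B),$$ and for any open ball $\widehat B$ in $\mathcal Z$ $$\lim_{N\to\infty}\frac1N\log Q_N(Y_N\in\widehat B\cap\mathcal W)=-I(\widehat B\cap\mathcal W).$$ Then, as $N\to\infty$, with respect to the measures $Q_N$, the sequence $Y_N$ satisfies the large deviation principle on $\mathcal W$ with rate function $I$ in the following sense. (a) For any compact subset $F$ of $\mathcal W$, $$\limsup_{N\to\infty}\frac1N\log Q_N(Y_N\in F)\le-I(F).$$ (b) For any closed subset $F$ of $\mathcal W$, $$\limsup_{N\to\infty}\frac1N\log Q_N(Y_N\in F)\le-I(\overline F),$$ where $\overline F$ denotes the closure of $F$ in $\mathcal Z$. (c) For any open subset $G$ of $\mathcal W$, $$\liminf_{N\to\infty}\frac1N\log Q_N(Y_N\in G)\ge-I(G).$$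
   Context: If $\tau$ is the metric on $\mathcal X$, open balls in $\mathcal W$ are the sets $\{y\in\mathcal W:\tau(x,y)<r\}$ with $x\in\mathcal W$, $r>0$, and open balls in $\mathcal Z$ are the sets $\{y\in\mathcal Z:\tau(x,y)<r\}$ with $x\in\mathcal Z$, $r>0$. Closed and open subsets of $\mathcal W$ are with respect to the subspace topology. "Random vector" means a measurable map. Conventions: $\log0=-\infty$, $\inf\emptyset=+\infty$. *)

theory Defs
  imports "HOL-Probability.Probability"
begin

(* Real logarithm with the convention log 0 = -infinity; note that the library has ln 0 = 0. *)
definition eln :: "real \<Rightarrow> ereal" where
  "eln p = (if p \<le> 0 then -\<infinity> else ereal (ln p))"

definition scaled_log_prob ::
    "(nat \<Rightarrow> 'w measure) \<Rightarrow> (nat \<Rightarrow> 'w \<Rightarrow> 'a) \<Rightarrow> 'a set \<Rightarrow> nat \<Rightarrow> ereal" where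
  "scaled_log_prob Q Y A N =
     ereal (1 / real N) * eln (measure (Q N) {\<omega> \<in> space (Q N). Y N \<omega> \<in> A})"

(* The balls of the metric subspace S: their centres have to lie in S. *)
definition open_balls_in :: "'a::metric_space set \<Rightarrow> 'a set set" where
  "open_balls_in S = {{y \<in> S. dist x y < r} | x r. x \<in> S \<and> 0 < r}"

definition lower_semicontinuous :: "('a::topological_space \<Rightarrow> ereal) \<Rightarrow> bool" where
  "lower_semicontinuous f \<longleftrightarrow> (\<forall>x. \<forall>a. a < f x \<longrightarrow> (\<forall>\<^sub>F y in nhds x. a < f y))"

(* In ereal the infimum over the empty set is +infinity. *)
definition inf_over :: "('a \<Rightarrow> ereal) \<Rightarrow> 'a set \<Rightarrow> ereal" where
  "inf_over I A = (INF x\<in>A. I x)"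

end

theory Submission
  imports Defs "HOL-Real_Asymp.Real_Asymp"
begin

text \<open>
  For the upper bounds, lower semicontinuity surrounds every point of the closure \<open>K\<close> of \<open>F\<close>
  in \<open>Z\<close> by a ball on which \<open>I\<close> exceeds any prescribed \<open>a < I(K)\<close>. Finitely many of
  these balls cover the compact set \<open>K\<close>, and passing from one ball to finitely many costs only a
  constant factor, which is negligible on the exponential scale. A compact \<open>F\<close> is its own
  closure, so (a) is a case of (b). For the lower bound, every point of an open set is the centre of a ball
  contained in that set.
\<close>

text \<open>For \<open>p \<le> 0\<close> both sides are true, because the left-hand value is then
  minus infinity; with the library value \<open>ln 0 = 0\<close> this would fail for negative
  \<open>t\<close>.\<close>

lemma eln_le_ereal_iff: "eln p \<le> ereal t \<longleftrightarrow> p \<le> exp t"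
proof (cases "p \<le> 0")
  case True
  then show ?thesis
    by (simp add: eln_def order_trans[OF True])
next
  case False
  then show ?thesis
    using ln_le_cancel_iff[of p "exp t"] by (simp add: eln_def)
qed

lemma eln_mono: "p \<le> q \<Longrightarrow> eln p \<le> eln q"
  by (auto simp: eln_def)

text \<open>Trades extended reals for real inequalities between probabilities, which can be summed.
  At \<open>N = 0\<close> the prefactor \<open>1 / real N\<close> is 0 and the scaled value is 0
  whatever the probability, hence \<open>N \<ge> 1\<close>.\<close>

lemma scaled_log_prob_le_ereal_iff:
  assumes "N \<ge> 1"
  shows "scaled_log_prob Q Y A N \<le> ereal c \<longleftrightarrow>
    measure (Q N) {\<omega> \<in> space (Q N). Y N \<omega> \<in> A} \<le> exp (real N * c)"
proof -
  have "scaled_log_prob Q Y A N \<le> ereal c \<longleftrightarrow>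
      eln (measure (Q N) {\<omega> \<in> space (Q N). Y N \<omega> \<in> A}) \<le> ereal (real N * c)"
    using assms
    by (cases "eln (measure (Q N) {\<omega> \<in> space (Q N). Y N \<omega> \<in> A})")
      (auto simp: scaled_log_prob_def field_simps)
  then show ?thesis
    by (simp add: eln_le_ereal_iff)
qed

lemma scaled_log_prob_mono:
  assumes "prob_space (Q N)" "A \<subseteq> B" "{\<omega> \<in> space (Q N). Y N \<omega> \<in> B} \<in> sets (Q N)"
  shows "scaled_log_prob Q Y A N \<le> scaled_log_prob Q Y B N"
proof -
  interpret prob_space "Q N" by fact
  have "measure (Q N) {\<omega> \<in> space (Q N). Y N \<omega> \<in> A} \<le> measure (Q N) {\<omega> \<in> space (Q N). Y N \<omega> \<in> B}"
    using assms by (intro finite_measure_mono) auto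
  then show ?thesis
    unfolding scaled_log_prob_def by (intro ereal_mult_left_mono eln_mono) auto
qed

text \<open>By the union bound the probability of \<open>F\<close> is at most \<open>card J\<close>
  times \<open>exp (real N * b)\<close>, and the gap \<open>b < c\<close> absorbs the factor
  \<open>card J\<close> for large \<open>N\<close>. Measurability is asked of the covering events
  alone: \<open>measure\<close> is 0 on non-measurable sets, so monotonicity looks only at the
  larger set.\<close>

lemma limsup_scaled_log_prob_cover_le:
  fixes b c :: real
  assumes prob: "\<And>N. N \<ge> 1 \<Longrightarrow> prob_space (Q N)"
    and meas: "\<And>i N. i \<in> J \<Longrightarrow> N \<ge> 1 \<Longrightarrow> {\<omega> \<in> space (Q N). Y N \<omega> \<in> A i} \<in> sets (Q N)"
    and J: "finite J" and cover: "F \<subseteq> (\<Union>i\<in>J. A i)" and "b < c"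
    and bound: "\<And>i. i \<in> J \<Longrightarrow> \<forall>\<^sub>F N in sequentially. scaled_log_prob Q Y (A i) N \<le> ereal b"
  shows "limsup (scaled_log_prob Q Y F) \<le> ereal c"
proof (rule Limsup_bounded)
  have "\<forall>\<^sub>F N in sequentially. \<forall>i\<in>J. scaled_log_prob Q Y (A i) N \<le> ereal b"
    using J bound by (simp add: eventually_ball_finite)
  moreover have "\<forall>\<^sub>F N in sequentially. real (card J) \<le> exp (real N * (c - b))"
    using \<open>b < c\<close> by real_asymp
  ultimately show "\<forall>\<^sub>F N in sequentially. scaled_log_prob Q Y F N \<le> ereal c"
    using eventually_ge_at_top[of 1]
  proof eventually_elim
    case (elim N)
    let ?E = "\<lambda>S. {\<omega> \<in> space (Q N). Y N \<omega> \<in> S}"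
    interpret prob_space "Q N" using prob elim by simp
    have "measure (Q N) (?E F) \<le> measure (Q N) (\<Union>i\<in>J. ?E (A i))"
      using cover J meas elim by (intro finite_measure_mono) auto
    also have "\<dots> \<le> (\<Sum>i\<in>J. measure (Q N) (?E (A i)))"
      using J meas elim by (intro measure_UNION_le) auto
    also have "\<dots> \<le> (\<Sum>i\<in>J. exp (real N * b))"
      using elim by (intro sum_mono) (simp add: scaled_log_prob_le_ereal_iff)
    also have "\<dots> \<le> exp (real N * (c - b)) * exp (real N * b)"
      using elim by (simp add: mult_right_mono)
    also have "\<dots> = exp (real N * c)"
      by (simp add: exp_add [symmetric] algebra_simps)
    finally show ?case
      using elim by (simp add: scaled_log_prob_le_ereal_iff)
  qed
qed

theorem theorem4p3:
  fixes Q :: "nat \<Rightarrow> 'w measure"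
    and Y :: "nat \<Rightarrow> 'w \<Rightarrow> 'a::polish_space"
    and W Z :: "'a set"
    and I :: "'a \<Rightarrow> ereal"
  assumes prob: "\<And>N. N \<ge> 1 \<Longrightarrow> prob_space (Q N)"
    and W_relcompact: "compact (closure W)"
    and W_not_closed: "\<not> closed W"
    and Z_def: "Z = closure W"
    and Y_meas: "\<And>N. N \<ge> 1 \<Longrightarrow> Y N \<in> measurable (Q N) (restrict_space borel W)"
    and I_nonneg: "\<And>x. 0 \<le> I x"
    and I_lsc: "lower_semicontinuous I"
    and lim_W: "\<And>B. B \<in> open_balls_in W \<Longrightarrow>
      scaled_log_prob Q Y B \<longlonglongrightarrow> - inf_over I B"
    and lim_Z: "\<And>B. B \<in> open_balls_in Z \<Longrightarrow>
      scaled_log_prob Q Y (B \<inter> W) \<longlonglongrightarrow> - inf_over I (B \<inter> W)"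
  shows "(\<forall>F. compact F \<and> F \<subseteq> W \<longrightarrow>
            limsup (scaled_log_prob Q Y F) \<le> - inf_over I F)
       \<and> (\<forall>F. closedin (top_of_set W) F \<longrightarrow>
            limsup (scaled_log_prob Q Y F) \<le> - inf_over I (top_of_set Z closure_of F))
       \<and> (\<forall>G. openin (top_of_set W) G \<longrightarrow>
            liminf (scaled_log_prob Q Y G) \<ge> - inf_over I G)"
proof -
  have open_meas: "{\<omega> \<in> space (Q N). Y N \<omega> \<in> A} \<in> sets (Q N)"
    if "openin (top_of_set W) A" "N \<ge> 1" for A N
  proof -
    obtain T where "open T" "A = W \<inter> T"
      using \<open>openin (top_of_set W) A\<close> by (auto simp: openin_open)
    then have "A \<in> sets (restrict_space borel W)"
      by (auto simp: sets_restrict_space)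
    from measurable_sets[OF Y_meas[OF \<open>N \<ge> 1\<close>] this] show ?thesis
      by (simp add: vimage_def Int_def conj_commute)
  qed

  \<comment> \<open>Stated for every subset of \<open>W\<close>, so that the closed sets and the
    compact sets are both instances.\<close>
  have closed_bound: "limsup (scaled_log_prob Q Y F) \<le> - inf_over I (top_of_set Z closure_of F)"
    if "F \<subseteq> W" for F
  proof (rule dense_ge)
    fix c assume c: "- inf_over I (top_of_set Z closure_of F) < c"
    define K where "K = top_of_set Z closure_of F"
    have K_compact: "compact K"
      unfolding K_def using W_relcompact Z_def closedin_closure_of[of "top_of_set Z" F]
      by (metis closedin_compact)
    have "K \<subseteq> Z" and "F \<subseteq> K"
      using closure_of_subset_topspace[of "top_of_set Z" F] closure_of_subset[of F "top_of_set Z"]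
        that closure_subset[of W] by (auto simp: K_def Z_def)
    show "limsup (scaled_log_prob Q Y F) \<le> c"
    proof (cases c)
      case (real c')
      \<comment> \<open>Two strict gaps are needed above \<open>- inf_over I K\<close>.
        Semicontinuity bounds \<open>I\<close> below by \<open>- a\<close> on each ball, but an
        infimum keeps only the weak inequality, so convergence gives an eventual bound by some
        \<open>b > a\<close>; the step from \<open>b\<close> to \<open>c'\<close> pays for the
        number of balls. Choosing real numbers also covers an infinite infimum over
        \<open>K\<close>.\<close>
      obtain b :: real where b: "- inf_over I K < ereal b" "b < c'"
        using c real ereal_dense2[of "- inf_over I K" c] by (auto simp: K_def)
      obtain a :: real where a: "- inf_over I K < ereal a" "a < b"
        using b ereal_dense2[of "- inf_over I K" b] by auto
      have "\<exists>r>0. \<forall>y\<in>ball x r. ereal (- a) < I y" if "x \<in> K" for x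
      proof -
        have "ereal (- a) < inf_over I K"
          using a(1) by (simp add: ereal_uminus_less_reorder)
        also have "\<dots> \<le> I x"
          unfolding inf_over_def by (rule INF_lower) fact
        finally show ?thesis
          using I_lsc unfolding lower_semicontinuous_def eventually_nhds_metric
          by (metis dist_commute mem_ball)
      qed
      then obtain r where r: "\<And>x. x \<in> K \<Longrightarrow> r x > 0"
        "\<And>x y. x \<in> K \<Longrightarrow> y \<in> ball x (r x) \<Longrightarrow> ereal (- a) < I y"
        by metis
      have "K \<subseteq> (\<Union>x\<in>K. ball x (r x))"
        using r(1) by auto
      then obtain J where J: "J \<subseteq> K" "finite J" "K \<subseteq> (\<Union>x\<in>J. ball x (r x))"
        using compactE_image[OF K_compact, of K "\<lambda>x. ball x (r x)"] by auto
      have "limsup (scaled_log_prob Q Y F) \<le> ereal c'"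
      proof (rule limsup_scaled_log_prob_cover_le[where J = J and A = "\<lambda>x. ball x (r x) \<inter> W"])
        show "F \<subseteq> (\<Union>x\<in>J. ball x (r x) \<inter> W)"
          using J \<open>F \<subseteq> K\<close> \<open>F \<subseteq> W\<close> by auto
        show "{\<omega> \<in> space (Q N). Y N \<omega> \<in> ball x (r x) \<inter> W} \<in> sets (Q N)" if "N \<ge> 1" for x N
          using that by (intro open_meas) (auto simp: openin_open)
        show "\<forall>\<^sub>F N in sequentially. scaled_log_prob Q Y (ball x (r x) \<inter> W) N \<le> ereal b"
          if "x \<in> J" for x
        proof -
          have "x \<in> K" using that J by auto
          \<comment> \<open>The centre \<open>x\<close> may lie in \<open>Z\<close> outside
            \<open>W\<close>, where \<open>lim_W\<close> says nothing; this is the place for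
            \<open>lim_Z\<close>.\<close>
          have "{y \<in> Z. dist x y < r x} \<in> open_balls_in Z"
            using \<open>x \<in> K\<close> \<open>K \<subseteq> Z\<close> r(1) by (auto simp: open_balls_in_def)
          moreover have "{y \<in> Z. dist x y < r x} \<inter> W = ball x (r x) \<inter> W"
            using closure_subset[of W] by (auto simp: Z_def)
          ultimately have lim: "scaled_log_prob Q Y (ball x (r x) \<inter> W)
              \<longlonglongrightarrow> - inf_over I (ball x (r x) \<inter> W)"
            using lim_Z by metis
          have "ereal (- a) \<le> inf_over I (ball x (r x) \<inter> W)"
            unfolding inf_over_def using r(2)[OF \<open>x \<in> K\<close>] by (intro INF_greatest) (auto intro: less_imp_le)
          then have "- inf_over I (ball x (r x) \<inter> W) \<le> ereal a"
            by (simp add: ereal_uminus_le_reorder)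
          also have "\<dots> < ereal b" using a by simp
          finally show ?thesis
            by (rule eventually_mono[OF order_tendstoD(2)[OF lim]]) (rule less_imp_le)
        qed
      qed (use prob J b in auto)
      then show ?thesis by (simp add: real)
    qed (use c in auto)
  qed

  have "limsup (scaled_log_prob Q Y F) \<le> - inf_over I F" if "compact F" "F \<subseteq> W" for F
  proof -
    have "top_of_set Z closure_of F = F"
      using that closure_subset[of W]
      by (intro closure_of_closedin closed_subset) (auto simp: Z_def compact_imp_closed)
    then show ?thesis
      using closed_bound[OF \<open>F \<subseteq> W\<close>] by simp
  qed
  moreover have "- inf_over I G \<le> liminf (scaled_log_prob Q Y G)"
    if G: "openin (top_of_set W) G" for G
  proof -
    \<comment> \<open>Negating turns the claim into a lower bound for \<open>I\<close> at each point
      of \<open>G\<close>, which \<open>INF_greatest\<close> then collects; an empty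
      \<open>G\<close> is included.\<close>
    have "- liminf (scaled_log_prob Q Y G) \<le> I x" if "x \<in> G" for x
    proof -
      have "x \<in> W"
        using openin_imp_subset[OF G] \<open>x \<in> G\<close> by blast
      obtain r where r: "r > 0" "ball x r \<inter> W \<subseteq> G"
        using G \<open>x \<in> G\<close> by (auto simp: openin_contains_ball)
      define B where "B = {y \<in> W. dist x y < r}"
      have "B \<in> open_balls_in W"
        using \<open>x \<in> W\<close> r by (auto simp: B_def open_balls_in_def)
      \<comment> \<open>The centre \<open>x\<close> belongs to \<open>B\<close>, so the infimum over
        \<open>B\<close> is at most \<open>I x\<close>.\<close>
      have "- I x \<le> - inf_over I B"
        using \<open>x \<in> W\<close> r by (auto simp: inf_over_def B_def intro: INF_lower)
      also have "\<dots> = liminf (scaled_log_prob Q Y B)"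
        using lim_imp_Liminf[OF _ lim_W[OF \<open>B \<in> open_balls_in W\<close>]] by simp
      also have "\<dots> \<le> liminf (scaled_log_prob Q Y G)"
      proof (rule Liminf_mono)
        show "\<forall>\<^sub>F N in sequentially. scaled_log_prob Q Y B N \<le> scaled_log_prob Q Y G N"
          \<comment> \<open>\<open>prob\<close> and \<open>Y_meas\<close> speak only of
            \<open>N \<ge> 1\<close>, so the comparison is made eventually.\<close>
          using eventually_ge_at_top[of 1]
        proof eventually_elim
          case (elim N)
          show ?case
            using r prob open_meas[OF G] elim
            by (intro scaled_log_prob_mono) (auto simp: B_def)
        qed
      qed
      finally show ?thesis
        by (simp add: ereal_uminus_le_reorder)
    qed
    then have "- liminf (scaled_log_prob Q Y G) \<le> inf_over I G"
      unfolding inf_over_def by (intro INF_greatest)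
    then show ?thesis
      by (simp add: ereal_uminus_le_reorder)
  qed
  ultimately show ?thesis
    using closed_bound[OF closedin_imp_subset] by simp
qed

end
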